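(* Let $n\geq 2$, let $X$ and $Y$ be two real $n$-normed spaces, and let $\phi\colon X\to Y$ be a surjective map such that for all $x_0,x_1,\dots,x_n\in X$ \[ \|x_1-x_0,\dots,x_n-x_0\|=1 \iff \|\phi(x_1)-\phi(x_0),\dots,\phi(x_n)-\phi(x_0)\|=1 . \] Then $\phi$ is an injective affine map, and therefore it is an $n$-isometry, i.e. \[ \|x_1-x_0,\dots,x_n-x_0\|=\|\phi(x_1)-\phi(x_0),\dots,\phi(x_n)-\phi(x_0)\| \qquad \text{for all } x_0,\dots,x_n\in X . \]
   Context: A (real) $n$-normed space is a real vector space $X$ with $\dim X\geq n$ (possibly infinite-dimensional) together with a function $\|\cdot,\dots,\cdot\|\colon X^n\to[0,\infty)$ (an $n$-norm) such that for all $x_1,\dots,x_n,\widetilde x_1\in X$: (1) $\|x_1,\dots,x_n\|=0$ if and only if $x_1,\dots,x_n$ are linearly dependent; (2) $\|x_1,\dots,x_n\|=\|x_{\sigma(1)},\dots,x_{\sigma(n)}\|$ for every permutation $\sigma\in S_n$; (3) $\|\alpha x_1,x_2,\dots,x_n\|=|\alpha|\,\|x_1,x_2,\dots,x_n\|$ for every $\alpha\in\mathbb{R}$; (4) $\|x_1+\widetilde x_1,x_2,\dots,x_n\|\leq\|x_1,x_2,\dots,x_n\|+\|\widetilde x_1,x_2,\dots,x_n\|$. The $n$-norms on $X$ and on $Y$ are denoted by the same symbol. An affine map is the sum of a linear map and a constant. *)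

theory Defs
  imports "HOL-Analysis.Analysis"
begin

text \<open>An \<open>n\<close>-tuple of vectors is a list of length \<open>n\<close>. Linear dependence is that of the family
  \<open>xs ! 0, \<dots>, xs ! (n - 1)\<close>, not of the set of its members: a tuple with a repeated entry is
  linearly dependent.\<close>

definition lin_dependent :: "'a::real_vector list \<Rightarrow> bool" where
  "lin_dependent xs \<longleftrightarrow>
     (\<exists>c. (\<exists>i<length xs. c i \<noteq> 0) \<and> (\<Sum>i<length xs. c i *\<^sub>R (xs ! i)) = 0)"

lemma lin_dependent_iff:
  "lin_dependent xs \<longleftrightarrow> \<not> distinct xs \<or> dependent (set xs)"
proof (cases "distinct xs")
  case True
  have bij: "bij_betw (\<lambda>i. xs ! i) {..<length xs} (set xs)"
    using True by (rule bij_betw_nth) auto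
  have S: "(\<Sum>i<length xs. u (xs ! i) *\<^sub>R (xs ! i)) = (\<Sum>v\<in>set xs. u v *\<^sub>R v)" for u
    using sum.reindex_bij_betw[OF bij, of "\<lambda>v. u v *\<^sub>R v"] .
  have "lin_dependent xs \<longleftrightarrow> (\<exists>u. (\<exists>v\<in>set xs. u v \<noteq> 0) \<and> (\<Sum>v\<in>set xs. u v *\<^sub>R v) = 0)"
    (is "_ \<longleftrightarrow> ?R")
  proof
    assume "lin_dependent xs"
    then obtain c i where c: "i < length xs" "c i \<noteq> 0" "(\<Sum>i<length xs. c i *\<^sub>R (xs ! i)) = 0"
      unfolding lin_dependent_def by blast
    define u where "u v = c (inv_into {..<length xs} (\<lambda>i. xs ! i) v)" for v
    have u: "u (xs ! j) = c j" if "j < length xs" for j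
      unfolding u_def using bij that by (simp add: bij_betw_def inv_into_f_f)
    have "(\<Sum>v\<in>set xs. u v *\<^sub>R v) = 0"
      unfolding S[symmetric] using c(3) u by simp
    moreover have "u (xs ! i) \<noteq> 0" using u c by simp
    ultimately show ?R using c(1) nth_mem by blast
  next
    assume ?R
    then obtain u v where "v \<in> set xs" "u v \<noteq> 0" "(\<Sum>v\<in>set xs. u v *\<^sub>R v) = 0" by blast
    then show "lin_dependent xs"
      unfolding lin_dependent_def
      by (intro exI[of _ "\<lambda>i. u (xs ! i)"]) (auto simp: S in_set_conv_nth)
  qed
  then show ?thesis using True by (simp add: dependent_finite)
next
  case False
  then obtain i j where ij: "i < length xs" "j < length xs" "i \<noteq> j" "xs ! i = xs ! j"
    by (auto simp: distinct_conv_nth)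
  let ?c = "\<lambda>k. if k = i then 1 else if k = j then - 1 else (0::real)"
  have "(\<Sum>k<length xs. ?c k *\<^sub>R (xs ! k)) = (\<Sum>k\<in>{i, j}. ?c k *\<^sub>R (xs ! k))"
    using ij by (intro sum.mono_neutral_right) auto
  also have "\<dots> = 0" using ij by simp
  finally have "lin_dependent xs"
    unfolding lin_dependent_def using ij(1) by (intro exI[of _ ?c]) auto
  then show ?thesis using False by simp
qed

text \<open>The values of \<open>N\<close> on lists of length other than \<open>n\<close> are irrelevant. Since \<open>dim\<close> is \<open>0\<close> on
  infinite-dimensional spaces, \<open>dim X \<ge> n\<close> is expressed by an independent set of size \<open>n\<close>.\<close>

locale n_normed_space =
  fixes n :: nat and N :: "'a::real_vector list \<Rightarrow> real"
  assumes dim_ge: "\<exists>B::'a set. finite B \<and> card B = n \<and> independent B"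
    and nonneg: "length xs = n \<Longrightarrow> 0 \<le> N xs"
    and eq_0_iff: "length xs = n \<Longrightarrow> N xs = 0 \<longleftrightarrow> lin_dependent xs"
    and permute: "length xs = n \<Longrightarrow> \<sigma> permutes {..<n} \<Longrightarrow> N (permute_list \<sigma> xs) = N xs"
    and scale: "length (x # xs) = n \<Longrightarrow> N (\<alpha> *\<^sub>R x # xs) = \<bar>\<alpha>\<bar> * N (x # xs)"
    and triangle: "length (x # xs) = n \<Longrightarrow> N ((x + y) # xs) \<le> N (x # xs) + N (y # xs)"

definition affine_map :: "('a::real_vector \<Rightarrow> 'b::real_vector) \<Rightarrow> bool" where
  "affine_map f \<longleftrightarrow> (\<exists>L c. linear L \<and> (\<forall>x. f x = L x + c))"

definition n_isometry ::
  "nat \<Rightarrow> ('a::real_vector list \<Rightarrow> real) \<Rightarrow> ('b::real_vector list \<Rightarrow> real) \<Rightarrow> ('a \<Rightarrow> 'b) \<Rightarrow> bool" where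
  "n_isometry n NX NY f \<longleftrightarrow>
     (\<forall>x\<^sub>0 xs. length xs = n \<longrightarrow>
        NX (map (\<lambda>x. x - x\<^sub>0) xs) = NY (map (\<lambda>x. f x - f x\<^sub>0) xs))"

end

theory Submission
  imports Defs
begin

text \<open>
  The proof reads parallelism and midpoints off the unit \<open>n\<close>-distance. Say that \<open>u\<close> and \<open>v\<close> have a \<^emph>\<open>common unit
  complement\<close> if \<open>\<parallel>u, z\<^sub>2, \<dots>, z\<^sub>n\<parallel> = 1 = \<parallel>v, z\<^sub>2, \<dots>, z\<^sub>n\<parallel>\<close> for some \<open>z\<^sub>2, \<dots>, z\<^sub>n\<close>. Linearly
  independent \<open>u\<close> and \<open>v\<close> always have one: extend them to an independent \<open>n\<close>-tuple and let \<open>z\<^sub>2\<close> be a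
  multiple of \<open>u + v\<close>. On the other hand \<open>u\<close> and \<open>k u\<close> can have one only if \<open>\<bar>k\<bar> = 1\<close>. Hence, for
  distinct points, \<open>m\<close> is the midpoint of \<open>b\<close> and \<open>c\<close> if and only if \<open>b - m\<close> and \<open>c - m\<close> have a
  common unit complement while \<open>m - b\<close> and \<open>c - b\<close> have none. The map \<open>\<phi>\<close> respects common unit
  complements of difference vectors with the same base point, in both directions since it is
  surjective. Therefore it is injective and preserves midpoints, so \<open>L x = \<phi> x - \<phi> 0\<close> is additive,
  and it maps lines through \<open>0\<close> into lines through \<open>0\<close>.

  It remains to see that \<open>L (t x) = t L x\<close>. Complete \<open>x\<close> to a tuple \<open>x, y, w\<^sub>3, \<dots>, w\<^sub>n\<close> of \<open>n\<close>-norm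
  \<open>1\<close>. Then \<open>L\<close> treats multiples of \<open>x\<close>, \<open>y\<close> and \<open>x + y\<close> in the same way: \<open>L (t x) = s(t) L x\<close> and
  \<open>L (t y) = s(t) L y\<close> with an additive function \<open>s\<close>. For two vectors in the plane of \<open>x\<close> and \<open>y\<close>,
  completed by \<open>w\<^sub>3, \<dots>, w\<^sub>n\<close>, the \<open>n\<close>-norm is the absolute value of a \<open>2 \<times> 2\<close> determinant. The
  matrix with rows \<open>(t, 1)\<close> and \<open>(t\<^sup>2 - 1, t)\<close> has determinant \<open>1\<close>, so its image under \<open>s\<close> has
  determinant \<open>\<plusminus>1\<close>, that is,
  \<open>(s t)\<^sup>2 - s (t\<^sup>2) + 1 = \<plusminus>1\<close>. Both signs give \<open>s (t\<^sup>2) \<ge> (s t)\<^sup>2\<close>. Thus the additive function \<open>s\<close> is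
  monotone with \<open>s 1 = 1\<close>, and it is the identity. The isometry property follows by
  rescaling one vector of a tuple to \<open>n\<close>-norm \<open>1\<close>.
\<close>

section \<open>Additive functions on the reals\<close>

text \<open>Such a function is monotone and fixes every rational, so a rational strictly between \<open>t\<close> and
  \<open>s t\<close> would contradict monotonicity.\<close>

lemma additive_nonneg_imp_identity:
  fixes s :: "real \<Rightarrow> real"
  assumes add: "\<And>a b. s (a + b) = s a + s b" and one: "s 1 = 1"
    and nonneg: "\<And>t. 0 \<le> t \<Longrightarrow> 0 \<le> s t"
  shows "s t = t"
proof -
  interpret additive s by standard (rule add)
  have nat: "s (of_nat m * a) = of_nat m * s a" for m a
    by (induction m) (auto simp: zero add distrib_right)
  have int: "s (of_int z * a) = of_int z * s a" for z a
    by (cases z rule: int_cases2) (auto simp: nat minus)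
  have rat: "s q = q" if q: "q \<in> \<rat>" for q
  proof -
    obtain z m :: int where zm: "q = of_int z / of_int m" "m > 0"
      by (rule Rats_cases'[OF q])
    then have mq: "of_int m * q = of_int z * 1"
      by simp
    have "of_int m * s q = of_int m * q"
      unfolding int[symmetric] mq unfolding int one ..
    then show ?thesis
      using zm(2) by simp
  qed
  have mono: "s a \<le> s b" if "a \<le> b" for a b
    using nonneg[of "b - a"] that by (simp add: diff)
  show ?thesis
  proof (rule antisym; rule ccontr)
    assume "\<not> s t \<le> t"
    then obtain q where "q \<in> \<rat>" "t < q" "q < s t"
      using Rats_dense_in_real[of t "s t"] by auto
    then show False
      using mono[of t q] rat by auto
  next
    assume "\<not> t \<le> s t"
    then obtain q where "q \<in> \<rat>" "s t < q" "q < t"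
      using Rats_dense_in_real[of "s t" t] by auto
    then show False
      using mono[of q t] rat by auto
  qed
qed

section \<open>Common unit complements in an n-normed space\<close>

definition common_unit_complement ::
  "nat \<Rightarrow> ('a::real_vector list \<Rightarrow> real) \<Rightarrow> 'a \<Rightarrow> 'a \<Rightarrow> bool" where
  "common_unit_complement n N u v \<longleftrightarrow>
     (\<exists>zs. Suc (length zs) = n \<and> N (u # zs) = 1 \<and> N (v # zs) = 1)"

context n_normed_space
begin

lemma norm_Cons_0: "length (x # xs) = n \<Longrightarrow> N (0 # xs) = 0"
  using scale[of 0 xs 0] by simp

lemma norm_Cons_same: "length (x # x # xs) = n \<Longrightarrow> N (x # x # xs) = 0"
  using eq_0_iff[of "x # x # xs"] by (simp add: lin_dependent_iff)

lemma norm_swap: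
  assumes "length (x # y # xs) = n"
  shows "N (y # x # xs) = N (x # y # xs)"
proof -
  let ?\<sigma> = "Transposition.transpose 0 (1::nat)"
  have "?\<sigma> permutes {..<n}"
    using assms by (intro permutes_swap_id) auto
  moreover have "permute_list ?\<sigma> (x # y # xs) = y # x # xs"
  proof (rule nth_equalityI)
    fix i assume i: "i < length (permute_list ?\<sigma> (x # y # xs))"
    consider "i = 0" | "i = 1" | j where "i = Suc (Suc j)"
      by (metis One_nat_def not0_implies_Suc)
    then show "permute_list ?\<sigma> (x # y # xs) ! i = (y # x # xs) ! i"
      using i by cases (simp_all add: permute_list_def Transposition.transpose_def del: upt_Suc)
  qed simp
  ultimately show ?thesis
    using permute[of "x # y # xs" ?\<sigma>] assms by simp
qed

lemma norm_add_multiple: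
  assumes "length (x # y # xs) = n"
  shows "N ((x + c *\<^sub>R y) # y # xs) = N (x # y # xs)"
proof (rule antisym)
  have zero: "N (r *\<^sub>R y # y # xs) = 0" for r
    using scale[of y "y # xs" r] norm_Cons_same[of y xs] assms by simp
  show "N ((x + c *\<^sub>R y) # y # xs) \<le> N (x # y # xs)"
    using triangle[of x "y # xs" "c *\<^sub>R y"] zero[of c] assms by simp
  show "N (x # y # xs) \<le> N ((x + c *\<^sub>R y) # y # xs)"
    using triangle[of "x + c *\<^sub>R y" "y # xs" "(- c) *\<^sub>R y"] zero[of "- c"] assms by simp
qed

text \<open>Both the scaling of an entry and the addition of a multiple of another entry act on the
  \<open>n\<close>-norm as on a determinant, so elementary row operations compute it.\<close>

lemma norm_det2:
  assumes len: "length (x # y # xs) = n"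
  shows "N ((a *\<^sub>R x + b *\<^sub>R y) # (c *\<^sub>R x + d *\<^sub>R y) # xs) = \<bar>a * d - b * c\<bar> * N (x # y # xs)"
proof -
  have main: "N ((a *\<^sub>R x + b *\<^sub>R y) # (c *\<^sub>R x + d *\<^sub>R y) # xs) = \<bar>a * d - b * c\<bar> * N (x # y # xs)"
    if len: "length (x # y # xs) = n" and "d \<noteq> 0" for x y a b c d
  proof -
    let ?v = "c *\<^sub>R x + d *\<^sub>R y"
    have "a *\<^sub>R x + b *\<^sub>R y = (a - b * c / d) *\<^sub>R x + (b / d) *\<^sub>R ?v"
      using \<open>d \<noteq> 0\<close> by (simp add: algebra_simps)
    then have "N ((a *\<^sub>R x + b *\<^sub>R y) # ?v # xs) = N ((a - b * c / d) *\<^sub>R x # ?v # xs)"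
      using norm_add_multiple[of _ ?v xs] len by simp
    also have "\<dots> = \<bar>a - b * c / d\<bar> * N (?v # x # xs)"
      using scale[of x "?v # xs"] norm_swap[of x ?v xs] len by simp
    also have "N (?v # x # xs) = N (d *\<^sub>R y # x # xs)"
      using norm_add_multiple[of "d *\<^sub>R y" x xs c] len by (simp add: add.commute)
    also have "\<dots> = \<bar>d\<bar> * N (x # y # xs)"
      using scale[of y "x # xs"] norm_swap[of x y xs] len by simp
    finally show ?thesis
      using \<open>d \<noteq> 0\<close> by (simp add: abs_mult[symmetric] field_simps)
  qed
  consider "d \<noteq> 0" | "d = 0" "c \<noteq> 0" | "d = 0" "c = 0"
    by blast
  then show ?thesis
  proof cases
    case 1
    with main len show ?thesis by blast
  next
    case 2
    then show ?thesis
      using main[of y x c b a d] norm_swap[of x y xs] len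
      by (simp add: add.commute abs_minus_commute)
  next
    case 3
    then show ?thesis
      using norm_swap[of 0 "a *\<^sub>R x + b *\<^sub>R y" xs] norm_Cons_0[of x "(a *\<^sub>R x + b *\<^sub>R y) # xs"] len
      by simp
  qed
qed

text \<open>A maximal independent subset of the union of \<open>set xs\<close> with an \<open>n\<close>-element independent set,
  chosen to contain \<open>set xs\<close>, has at least \<open>n\<close> elements.\<close>

lemma extend_to_nonzero_norm:
  assumes dist: "distinct xs" and ind: "independent (set xs)" and le: "length xs \<le> n"
  obtains zs where "length (xs @ zs) = n" "N (xs @ zs) \<noteq> 0"
proof -
  obtain B :: "'a set" where B: "finite B" "card B = n" "independent B"
    using dim_ge by blast
  obtain E where E: "set xs \<subseteq> E" "E \<subseteq> set xs \<union> B" "independent E" "set xs \<union> B \<subseteq> span E"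
    using maximal_independent_subset_extend[OF Un_upper1 ind] by metis
  have finE: "finite E"
    using E(2) B(1) finite_subset by blast
  have "n \<le> card E"
    using independent_span_bound[OF finE B(3)] E(4) B(2) by auto
  then have "n - length xs \<le> card (E - set xs)"
    using dist E(1) by (simp add: card_Diff_subset distinct_card)
  then obtain Z where Z: "Z \<subseteq> E - set xs" "card Z = n - length xs" "finite Z"
    by (rule obtain_subset_with_card_n)
  obtain zs where zs: "set zs = Z" "distinct zs"
    using finite_distinct_list[OF Z(3)] by blast
  have len: "length (xs @ zs) = n"
    using distinct_card[OF zs(2)] zs(1) Z(2) le by simp
  have "independent (set (xs @ zs))"
    by (rule independent_mono[OF E(3)]) (use E(1) Z(1) zs(1) in auto)
  moreover have "distinct (xs @ zs)"
    using dist zs Z(1) by auto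
  ultimately have "N (xs @ zs) \<noteq> 0"
    using eq_0_iff[OF len] by (simp add: lin_dependent_iff)
  with len show ?thesis by (rule that)
qed

lemma normalize_head:
  assumes "length (x # xs) = n" "N (x # xs) \<noteq> 0"
  shows "N ((1 / N (x # xs)) *\<^sub>R x # xs) = 1"
  using scale[of x xs "1 / N (x # xs)"] nonneg[of "x # xs"] assms by simp

lemma common_unit_complement_imp_nonzero:
  assumes "common_unit_complement n N u v"
  shows "u \<noteq> 0"
proof
  assume "u = 0"
  then obtain zs where "Suc (length zs) = n" "N (0 # zs) = 1"
    using assms by (auto simp: common_unit_complement_def)
  then show False
    using norm_Cons_0[of 0 zs] by simp
qed

lemma common_unit_complement_multiple:
  assumes "common_unit_complement n N u (k *\<^sub>R u)"
  shows "\<bar>k\<bar> = 1"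
proof -
  obtain zs where "Suc (length zs) = n" "N (u # zs) = 1" "N (k *\<^sub>R u # zs) = 1"
    using assms by (auto simp: common_unit_complement_def)
  then show ?thesis
    using scale[of u zs k] by simp
qed

lemma unit_tuple_with_head_direction:
  assumes "2 \<le> n" "x \<noteq> 0"
  obtains y ws where "length (x # y # ws) = n" "N (x # y # ws) = 1"
proof -
  obtain zs where zs: "length ([x] @ zs) = n" "N ([x] @ zs) \<noteq> 0"
    using extend_to_nonzero_norm[of "[x]"] assms by auto
  obtain y ws where yws: "zs = y # ws"
    using zs(1) assms(1) by (cases zs) auto
  let ?c = "N (y # x # ws)"
  have len: "length (y # x # ws) = n" and "?c \<noteq> 0"
    using zs norm_swap[of x y ws] by (auto simp: yws)
  then have "N (x # (1 / ?c) *\<^sub>R y # ws) = 1"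
    using normalize_head[of y "x # ws"] norm_swap[of x "(1 / ?c) *\<^sub>R y" ws] by simp
  then show ?thesis
    using that len by simp
qed

lemma common_unit_complement_uminus:
  assumes "2 \<le> n" "u \<noteq> 0"
  shows "common_unit_complement n N (- u) u"
proof -
  obtain y ws where "length (u # y # ws) = n" "N (u # y # ws) = 1"
    using unit_tuple_with_head_direction assms by blast
  then show ?thesis
    using scale[of u "y # ws" "- 1"]
    by (auto simp: common_unit_complement_def intro!: exI[of _ "y # ws"])
qed

text \<open>If \<open>c = \<parallel>u, v, w\<^sub>3, \<dots>, w\<^sub>n\<parallel> > 0\<close>, then \<open>(u + v) / c, w\<^sub>3, \<dots>, w\<^sub>n\<close> is a common unit
  complement.\<close>

lemma common_unit_complement_if_not_multiple:
  assumes n: "2 \<le> n" and u: "u \<noteq> 0" and v: "\<And>k. v \<noteq> k *\<^sub>R u"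
  shows "common_unit_complement n N u v"
proof -
  have "u \<noteq> v"
    using v[of 1] by auto
  moreover have "independent {u, v}"
    using independent_insertI[of v "{u}"] u v by (auto simp: insert_commute span_singleton)
  ultimately obtain ws where "length ([u, v] @ ws) = n" "N ([u, v] @ ws) \<noteq> 0"
    using extend_to_nonzero_norm[of "[u, v]"] n by auto
  then have len: "length (u # v # ws) = n" and ne: "N (u # v # ws) \<noteq> 0"
    by auto
  define r where "r = 1 / N (u # v # ws)"
  have r: "\<bar>r\<bar> * N (u # v # ws) = 1"
    using ne nonneg[OF len] by (simp add: r_def)
  have "N (u # (r *\<^sub>R u + r *\<^sub>R v) # ws) = 1"
    using norm_det2[OF len, of 1 0 r r] r by simp
  moreover have "N (v # (r *\<^sub>R u + r *\<^sub>R v) # ws) = 1"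
    using norm_det2[OF len, of 0 1 r r] r by simp
  ultimately show ?thesis
    unfolding common_unit_complement_def
    using len by (intro exI[of _ "(r *\<^sub>R u + r *\<^sub>R v) # ws"]) auto
qed

end

section \<open>Surjections that preserve the unit n-distance in both directions\<close>

locale unit_distance_preserver =
  X: n_normed_space n NX + Y: n_normed_space n NY
  for n :: nat and NX :: "'a::real_vector list \<Rightarrow> real" and NY :: "'b::real_vector list \<Rightarrow> real" +
  fixes \<phi> :: "'a \<Rightarrow> 'b"
  assumes n_ge_2: "2 \<le> n"
    and surj: "surj \<phi>"
    and unit: "length xs = n \<Longrightarrow>
      NX (map (\<lambda>x. x - x\<^sub>0) xs) = 1 \<longleftrightarrow> NY (map (\<lambda>x. \<phi> x - \<phi> x\<^sub>0) xs) = 1"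
begin

lemma common_unit_complement_iff:
  "common_unit_complement n NX (b - a) (c - a) \<longleftrightarrow>
   common_unit_complement n NY (\<phi> b - \<phi> a) (\<phi> c - \<phi> a)"
proof
  assume "common_unit_complement n NX (b - a) (c - a)"
  then obtain zs where zs: "Suc (length zs) = n" "NX ((b - a) # zs) = 1" "NX ((c - a) # zs) = 1"
    by (auto simp: common_unit_complement_def)
  let ?zs = "map (\<lambda>z. z + a) zs"
  have "map (\<lambda>x. x - a) (d # ?zs) = (d - a) # zs" for d
    by (simp add: o_def)
  then show "common_unit_complement n NY (\<phi> b - \<phi> a) (\<phi> c - \<phi> a)"
    unfolding common_unit_complement_def
    using unit[of "b # ?zs" a] unit[of "c # ?zs" a] zs
    by (intro exI[of _ "map (\<lambda>x. \<phi> x - \<phi> a) ?zs"]) (auto simp: o_def)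
next
  assume "common_unit_complement n NY (\<phi> b - \<phi> a) (\<phi> c - \<phi> a)"
  then obtain zs where zs: "Suc (length zs) = n"
    "NY ((\<phi> b - \<phi> a) # zs) = 1" "NY ((\<phi> c - \<phi> a) # zs) = 1"
    by (auto simp: common_unit_complement_def)
  let ?zs = "map (\<lambda>z. inv \<phi> (z + \<phi> a)) zs"
  have "map (\<lambda>x. \<phi> x - \<phi> a) (d # ?zs) = (\<phi> d - \<phi> a) # zs" for d
    by (simp add: o_def surj_f_inv_f[OF surj])
  then show "common_unit_complement n NX (b - a) (c - a)"
    unfolding common_unit_complement_def
    using unit[of "b # ?zs" a] unit[of "c # ?zs" a] zs
    by (intro exI[of _ "map (\<lambda>x. x - a) ?zs"]) (auto simp: o_def)
qed

text \<open>For \<open>a \<noteq> b\<close> the difference \<open>b - a\<close> has a common unit complement with itself, and \<open>0\<close> has none.\<close>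

lemma injective: "inj \<phi>"
proof (rule injI, rule ccontr)
  fix a b assume eq: "\<phi> a = \<phi> b" and "a \<noteq> b"
  then obtain y ws where "length ((b - a) # y # ws) = n" "NX ((b - a) # y # ws) = 1"
    using X.unit_tuple_with_head_direction[of "b - a"] n_ge_2 by auto
  then have "common_unit_complement n NX (b - a) (b - a)"
    by (auto simp: common_unit_complement_def intro!: exI[of _ "y # ws"])
  then have "common_unit_complement n NY (\<phi> b - \<phi> a) (\<phi> b - \<phi> a)"
    by (simp only: common_unit_complement_iff)
  then have "\<phi> b - \<phi> a \<noteq> 0"
    by (rule Y.common_unit_complement_imp_nonzero)
  with eq show False by simp
qed

text \<open>In terms of \<open>w = m - b \<noteq> 0\<close>, the vectors \<open>w\<close> and \<open>2 w\<close> have no common unit complement, which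
  forces the images of \<open>m - b\<close> and \<open>c - b\<close> to be parallel. The vectors \<open>- w\<close> and \<open>w\<close> have one, which
  leaves only the ratios \<open>0\<close> and \<open>2\<close> between them, and injectivity excludes \<open>0\<close>.\<close>

lemma midpoint:
  assumes "b + c = 2 *\<^sub>R m"
  shows "\<phi> b + \<phi> c = 2 *\<^sub>R \<phi> m"
proof (cases "m = b")
  case True
  then show ?thesis using assms by (simp add: scaleR_2)
next
  case False
  define w where "w = m - b"
  have w: "w \<noteq> 0" "b - m = - w" "c - m = w" "c - b = 2 *\<^sub>R w"
    using False assms by (auto simp: w_def scaleR_2 algebra_simps)
  define u where "u = \<phi> m - \<phi> b"
  have u: "u \<noteq> 0"
    using injD[OF injective] False by (auto simp: u_def)
  have "\<not> common_unit_complement n NX (m - b) (c - b)"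
    using X.common_unit_complement_multiple[of w 2] by (auto simp: w(4) w_def)
  then have "\<not> common_unit_complement n NY u (\<phi> c - \<phi> b)"
    by (simp only: common_unit_complement_iff u_def not_False_eq_True)
  then obtain k where k: "\<phi> c - \<phi> b = k *\<^sub>R u"
    using Y.common_unit_complement_if_not_multiple[OF n_ge_2 u] by blast
  have "common_unit_complement n NX (b - m) (c - m)"
    using X.common_unit_complement_uminus[OF n_ge_2 w(1)] by (simp add: w)
  then have "common_unit_complement n NY (\<phi> b - \<phi> m) (\<phi> c - \<phi> m)"
    by (simp only: common_unit_complement_iff)
  moreover have "\<phi> b - \<phi> m = - u"
    by (simp add: u_def)
  moreover have "\<phi> c - \<phi> m = (1 - k) *\<^sub>R - u"
    using k by (simp add: u_def algebra_simps)
  ultimately have "\<bar>1 - k\<bar> = 1"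
    using Y.common_unit_complement_multiple by metis
  moreover have "k \<noteq> 0"
  proof
    assume "k = 0"
    then have "c = b"
      using k injD[OF injective, of c b] by simp
    then show False using w by simp
  qed
  ultimately have "k = 2" by arith
  then show ?thesis
    using k by (simp add: u_def scaleR_2 algebra_simps)
qed

definition L :: "'a \<Rightarrow> 'b" where "L x = \<phi> x - \<phi> 0"

lemma L_0 [simp]: "L 0 = 0"
  by (simp add: L_def)

lemma L_eq_0_iff [simp]: "L x = 0 \<longleftrightarrow> x = 0"
  using injD[OF injective, of x 0] by (auto simp: L_def)

lemma L_unit: "length xs = n \<Longrightarrow> NX xs = 1 \<longleftrightarrow> NY (map L xs) = 1"
  using unit[of xs 0] by (simp add: L_def[abs_def])

lemma L_add: "L (x + y) = L x + L y"
proof -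
  have double: "L (2 *\<^sub>R z) = 2 *\<^sub>R L z" for z
    using midpoint[of 0 "2 *\<^sub>R z" z] by (simp add: L_def scaleR_2 algebra_simps)
  have half: "2 *\<^sub>R ((1/2) *\<^sub>R (x + y)) = x + y"
    by simp
  have "\<phi> x + \<phi> y = 2 *\<^sub>R \<phi> ((1/2) *\<^sub>R (x + y))"
    by (rule midpoint) simp
  then have "L x + L y = 2 *\<^sub>R L ((1/2) *\<^sub>R (x + y))"
    by (simp add: L_def scaleR_2 algebra_simps)
  also have "\<dots> = L (x + y)"
    by (simp only: double[symmetric] half)
  finally show ?thesis by simp
qed

lemma L_minus: "L (- x) = - L x"
  using L_add[of x "- x"] by (simp add: eq_neg_iff_add_eq_0 add.commute)

text \<open>If \<open>L x\<close> and \<open>L (t x)\<close> were not parallel, they would have a common unit complement, and so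
  would \<open>x\<close> and \<open>t x\<close>. This is possible only for \<open>t = \<plusminus>1\<close>, where additivity gives the claim.\<close>

lemma L_line: "\<exists>k. L (t *\<^sub>R x) = k *\<^sub>R L x"
proof (cases "x = 0 \<or> \<bar>t\<bar> = 1")
  case True
  then consider "x = 0" | "t = 1" | "t = - 1" by linarith
  then show ?thesis
  proof cases
    case 3
    then show ?thesis by (auto simp: L_minus intro!: exI[of _ "- 1"])
  qed (auto intro: exI[of _ 1])
next
  case False
  then have "\<not> common_unit_complement n NX (x - 0) (t *\<^sub>R x - 0)"
    using X.common_unit_complement_multiple[of x t] by auto
  then have "\<not> common_unit_complement n NY (L x) (L (t *\<^sub>R x))"
    by (simp only: common_unit_complement_iff L_def not_False_eq_True)
  then show ?thesis
    using Y.common_unit_complement_if_not_multiple[OF n_ge_2, of "L x"] False by auto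
qed

text \<open>The functional equation that makes \<open>s\<close> monotone comes from a matrix of determinant \<open>1\<close> whose
  entries are \<open>1\<close>, \<open>r\<close> and \<open>r\<^sup>2 - 1\<close>. Preservation of the unit \<open>n\<close>-distance determines the image
  determinant only up to sign, and the resulting inequality \<open>(s r)\<^sup>2 \<le> s (r\<^sup>2)\<close> holds for either
  sign.\<close>

lemma L_scale: "L (t *\<^sub>R x) = t *\<^sub>R L x"
proof (cases "x = 0")
  case False
  obtain y ws where len: "length (x # y # ws) = n" and xy1: "NX (x # y # ws) = 1"
    using X.unit_tuple_with_head_direction[OF n_ge_2 False] by blast
  have len': "length (L x # L y # map L ws) = n"
    using len by simp
  have Lxy1: "NY (L x # L y # map L ws) = 1"
    using L_unit[OF len] xy1 by simp
  define s where "s t = (SOME k. L (t *\<^sub>R x) = k *\<^sub>R L x)" for t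
  have sx: "L (t *\<^sub>R x) = s t *\<^sub>R L x" for t
    unfolding s_def by (rule someI_ex) (rule L_line)
  \<comment> \<open>The scalar for \<open>y\<close> agrees with that for \<open>x\<close>, since both agree with that for \<open>x + y\<close>.\<close>
  have sy: "L (t *\<^sub>R y) = s t *\<^sub>R L y" for t
  proof -
    obtain k where k: "L (t *\<^sub>R y) = k *\<^sub>R L y"
      using L_line by blast
    obtain j where j: "L (t *\<^sub>R (x + y)) = j *\<^sub>R L (x + y)"
      using L_line by blast
    have "s t *\<^sub>R L x + k *\<^sub>R L y = j *\<^sub>R L x + j *\<^sub>R L y"
      using j by (simp add: L_add sx k scaleR_add_right)
    then have eq: "(s t - j) *\<^sub>R L x + (k - j) *\<^sub>R L y = 0"
      by (simp add: algebra_simps)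
    \<comment> \<open>A vanishing combination of \<open>L x\<close> and \<open>L y\<close> makes every determinant containing it vanish.\<close>
    have "s t - j = 0"
      using Y.norm_det2[OF len', of "s t - j" "k - j" 0 1] eq Lxy1
        Y.norm_Cons_0[of "L x" "L y # map L ws"] len' by simp
    moreover have "k - j = 0"
      using Y.norm_det2[OF len', of "s t - j" "k - j" 1 0] eq Lxy1
        Y.norm_Cons_0[of "L x" "L x # map L ws"] len' by simp
    ultimately show ?thesis using k by simp
  qed
  have Lx: "L x \<noteq> 0"
    using False by simp
  have s_add: "s (a + b) = s a + s b" for a b
  proof -
    have "s (a + b) *\<^sub>R L x = (s a + s b) *\<^sub>R L x"
      by (simp only: sx[symmetric] scaleR_add_left L_add)
    then show ?thesis using Lx by simp
  qed
  have s_1: "s 1 = 1"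
    using sx[of 1] Lx by (metis scaleR_cancel_right scaleR_one)
  have s_square: "(s r)\<^sup>2 \<le> s (r\<^sup>2)" for r
  proof -
    let ?p = "r *\<^sub>R x + 1 *\<^sub>R y" and ?q = "(r\<^sup>2 - 1) *\<^sub>R x + r *\<^sub>R y"
    have "NX (?p # ?q # ws) = 1"
      using X.norm_det2[OF len, of r 1 "r\<^sup>2 - 1" r] xy1 by (simp add: power2_eq_square)
    then have "NY (map L (?p # ?q # ws)) = 1"
      using L_unit[of "?p # ?q # ws"] len by simp
    moreover have "L ?p = s r *\<^sub>R L x + 1 *\<^sub>R L y"
      by (simp add: L_add sx)
    moreover have "L ?q = s (r\<^sup>2 - 1) *\<^sub>R L x + s r *\<^sub>R L y"
      by (simp add: L_add sx sy)
    ultimately have "\<bar>s r * s r - 1 * s (r\<^sup>2 - 1)\<bar> = 1"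
      using Y.norm_det2[OF len', of "s r" 1 "s (r\<^sup>2 - 1)" "s r"] Lxy1 by simp
    moreover have "s (r\<^sup>2 - 1) = s (r\<^sup>2) - 1"
      using s_add[of "r\<^sup>2 - 1" 1] s_1 by simp
    ultimately show ?thesis
      by (simp add: power2_eq_square)
  qed
  have "0 \<le> s r" if "0 \<le> r" for r
    using order_trans[OF zero_le_power2 s_square[of "sqrt r"]] that by simp
  then have "s t = t"
    using additive_nonneg_imp_identity s_add s_1 by blast
  then show ?thesis
    using sx by simp
qed simp

lemma linear_L: "linear L"
  by (rule linearI) (rule L_add, rule L_scale)

lemma L_norm:
  assumes len: "length xs = n"
  shows "NX xs = NY (map L xs)"
proof -
  obtain y zs where xs: "xs = y # zs"
    using len n_ge_2 by (cases xs) auto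
  have scaled: "NX ((1 / r) *\<^sub>R y # zs) = 1 \<longleftrightarrow> NY ((1 / r) *\<^sub>R L y # map L zs) = 1" for r
    using L_unit[of "(1 / r) *\<^sub>R y # zs"] len by (simp add: xs L_scale)
  have lenX: "length (y # zs) = n" and lenY: "length (L y # map L zs) = n"
    using len by (auto simp: xs)
  let ?a = "NX (y # zs)" and ?b = "NY (L y # map L zs)"
  have ge: "0 \<le> ?a" "0 \<le> ?b"
    using X.nonneg[OF lenX] Y.nonneg[OF lenY] by auto
  have "?a = ?b"
  proof (cases "?a = 0")
    case False
    then have "NY ((1 / ?a) *\<^sub>R L y # map L zs) = 1"
      using scaled X.normalize_head[OF lenX] by blast
    then show ?thesis
      using Y.scale[OF lenY, of "1 / ?a"] ge False by (simp add: field_simps)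
  next
    case True
    have "?b = 0"
    proof (rule ccontr)
      assume "?b \<noteq> 0"
      then have "NX ((1 / ?b) *\<^sub>R y # zs) = 1"
        using scaled Y.normalize_head[OF lenY] by blast
      then show False
        using X.scale[OF lenX, of "1 / ?b"] True by simp
    qed
    with True show ?thesis by simp
  qed
  then show ?thesis by (simp add: xs)
qed

lemma affine: "affine_map \<phi>"
  unfolding affine_map_def
  by (intro exI[of _ L] exI[of _ "\<phi> 0"] conjI linear_L) (simp add: L_def)

lemma isometry: "n_isometry n NX NY \<phi>"
proof -
  have "L (x - x\<^sub>0) = \<phi> x - \<phi> x\<^sub>0" for x x\<^sub>0
    by (simp add: linear_diff[OF linear_L]) (simp add: L_def)
  then show ?thesis
    unfolding n_isometry_def using L_norm by (auto simp: o_def)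
qed

end

theorem theorem2:
  fixes n :: nat
    and NX :: "'a::real_vector list \<Rightarrow> real"
    and NY :: "'b::real_vector list \<Rightarrow> real"
    and \<phi> :: "'a \<Rightarrow> 'b"
  assumes "n \<ge> 2"
    and "n_normed_space n NX"
    and "n_normed_space n NY"
    and "surj \<phi>"
    and "\<And>x\<^sub>0 xs. length xs = n \<Longrightarrow>
           NX (map (\<lambda>x. x - x\<^sub>0) xs) = 1 \<longleftrightarrow> NY (map (\<lambda>x. \<phi> x - \<phi> x\<^sub>0) xs) = 1"
  shows "inj \<phi> \<and> affine_map \<phi> \<and> n_isometry n NX NY \<phi>"
proof -
  interpret unit_distance_preserver n NX NY \<phi>
    using assms by (intro unit_distance_preserver.intro unit_distance_preserver_axioms.intro)
  show ?thesis
    using injective affine isometry by blast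
qed

end
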